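(* Let $\mathbf d^*=(0,\dots,0;d^*_{n,1},\dots,d^*_{n,m})=\arg\max_{\mathbf d\in\mathcal D}\eta^{\mathbf d}$ be the optimal policy. Then, no matter what the value of the service price $R$ is, for each $j=1,2,\dots,m$ the optimal decision element $d^*_{n,j}$ is either $0$ or $j$; i.e., the bang-bang control is optimal.
   Context: Model. Let $n,m\ge1$ be integers and $\lambda>0$, $\mu_1\ge\mu_2>0$. The state space is $\Omega=\{(0,0),(1,0),\dots,(n,0),(n,1),\dots,(n,m)\}$ (in this order). A policy is $\mathbf d=(0,\dots,0;d_{n,1},\dots,d_{n,m})$ with $d_{n,j}\in\{0,1,\dots,m\}$ (and $d_{i,0}=0$ for $0\le i\le n$); $\mathcal D$ is the set of all policies. Put $\nu(d_{n,j})=n\mu_1+(d_{n,j}\wedge j)\mu_2$ for $1\le j\le m$, where $a\wedge b=\min(a,b)$. $\mathbf B^{(\mathbf d)}$ is the generator of the birth-death process on $\Omega$ with birth rate $\lambda$ at every state except $(n,m)$ (birth rate $0$ there), death rate $i\mu_1$ at $(i,0)$ for $1\le i\le n$, and death rate $\nu(d_{n,j})$ at $(n,j)$ for $1\le j\le m$. $\boldsymbol\pi^{(\mathbf d)}$ is its unique stationary probability (row) vector. Reward. Let $R\ge 0$ (the service price), $P_{1,W}>0$, $0<P_{2,S}<P_{2,W}$, $C_1>0$, $0\le C_2^{(1)}\le C_2^{(2)}$, $C_3,C_4\ge0$ be constants. The reward column vector $\mathbf f^{(\mathbf d)}$ has entries, for $(i,j)\in\Omega$, $$f^{(\mathbf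 d)}(i,j)=R[i\mu_1+(j\wedge d_{i,j})\mu_2]-[nP_{1,W}+d_{i,j}P_{2,W}+(m-d_{i,j})P_{2,S}]C_1-[iC_2^{(1)}+jC_2^{(2)}]-i\mu_1 1_{\{j>0\}}C_3-\lambda 1_{\{i=n,j=m\}}C_4 .$$ The long-run average profit is $\eta^{\mathbf d}=\boldsymbol\pi^{(\mathbf d)}\mathbf f^{(\mathbf d)}$.
   Formalization: Optimal policies can tie, so not every one is bang-bang; proved instead: a bang-bang optimal policy exists, a unique optimal policy is bang-bang, and any optimal entry other than 0 or j lies strictly between them, with every decision from 0 to j at that entry then equally optimal. *)

theory Defs
  imports Complex_Main
begin

record server_params =
  grp1 :: nat       \<comment> \<open>\<open>n\<close>, size of group 1\<close>
  grp2 :: nat       \<comment> \<open>\<open>m\<close>, size of group 2\<close>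
  lam :: real       \<comment> \<open>arrival rate\<close>
  mu1 :: real
  mu2 :: real
  P1W :: real       \<comment> \<open>power of a working group-1 server\<close>
  P2S :: real       \<comment> \<open>power of a sleeping group-2 server\<close>
  P2W :: real       \<comment> \<open>power of a working group-2 server\<close>
  C1 :: real
  C2_1 :: real
  C2_2 :: real
  C3 :: real
  C4 :: real

type_synonym state = "nat \<times> nat"
type_synonym policy = "state \<Rightarrow> nat"

definition states :: "server_params \<Rightarrow> state set" where
  "states p = {(i, 0) | i. i \<le> grp1 p} \<union> {(grp1 p, j) | j. j \<le> grp2 p}"

text \<open>Policies are normalised to 0 outside the state space, so that a policy is determined by
  the entries \<open>d (n, 1), \<dots>, d (n, m)\<close>.\<close>

definition policies :: "server_params \<Rightarrow> policy set" where
  "policies p = {d. (\<forall>s \<in> states p. d s \<le> grp2 p) \<and> (\<forall>i \<le> grp1 p. d (i, 0) = 0) \<and>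
                    (\<forall>s. s \<notin> states p \<longrightarrow> d s = 0)}"

text \<open>The successor of a state in the linear order
  \<open>(0,0), (1,0), \<dots>, (n,0), (n,1), \<dots>, (n,m)\<close>.\<close>

fun next_state :: "server_params \<Rightarrow> state \<Rightarrow> state" where
  "next_state p (i, j) = (if i < grp1 p then (Suc i, j) else (i, Suc j))"

text \<open>Only meaningful on the state space without \<open>(0,0)\<close>.\<close>

fun death_rate :: "server_params \<Rightarrow> policy \<Rightarrow> state \<Rightarrow> real" where
  "death_rate p d (i, j) =
     (if j = 0 then real i * mu1 p
      else real (grp1 p) * mu1 p + real (min (d (grp1 p, j)) j) * mu2 p)"

definition trans_rate :: "server_params \<Rightarrow> policy \<Rightarrow> state \<Rightarrow> state \<Rightarrow> real" where
  "trans_rate p d s t =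
     (if s \<noteq> (grp1 p, grp2 p) \<and> t = next_state p s then lam p
      else if s = next_state p t then death_rate p d s
      else 0)"

definition generator :: "server_params \<Rightarrow> policy \<Rightarrow> state \<Rightarrow> state \<Rightarrow> real" where
  "generator p d s t =
     (if s = t then - (\<Sum>u \<in> states p - {s}. trans_rate p d s u) else trans_rate p d s t)"

definition is_stationary :: "server_params \<Rightarrow> policy \<Rightarrow> (state \<Rightarrow> real) \<Rightarrow> bool" where
  "is_stationary p d \<pi> \<longleftrightarrow>
     (\<forall>s \<in> states p. 0 \<le> \<pi> s) \<and> (\<forall>s. s \<notin> states p \<longrightarrow> \<pi> s = 0) \<and>
     (\<Sum>s \<in> states p. \<pi> s) = 1 \<and>
     (\<forall>t \<in> states p. (\<Sum>s \<in> states p. \<pi> s * generator p d s t) = 0)"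

definition stationary :: "server_params \<Rightarrow> policy \<Rightarrow> state \<Rightarrow> real" where
  "stationary p d = (THE \<pi>. is_stationary p d \<pi>)"

fun reward :: "server_params \<Rightarrow> real \<Rightarrow> policy \<Rightarrow> state \<Rightarrow> real" where
  "reward p R d (i, j) =
     R * (real i * mu1 p + real (min j (d (i, j))) * mu2 p)
     - (real (grp1 p) * P1W p + real (d (i, j)) * P2W p
        + (real (grp2 p) - real (d (i, j))) * P2S p) * C1 p
     - (real i * C2_1 p + real j * C2_2 p)
     - real i * mu1 p * (if j > 0 then 1 else 0) * C3 p
     - lam p * (if i = grp1 p \<and> j = grp2 p then 1 else 0) * C4 p"

definition avg_profit :: "server_params \<Rightarrow> real \<Rightarrow> policy \<Rightarrow> real" where
  "avg_profit p R d = (\<Sum>s \<in> states p. stationary p d s * reward p R d s)"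

definition optimal_policy :: "server_params \<Rightarrow> real \<Rightarrow> policy \<Rightarrow> bool" where
  "optimal_policy p R d \<longleftrightarrow> is_arg_max (avg_profit p R) (\<lambda>d. d \<in> policies p) d"

definition bang_bang :: "server_params \<Rightarrow> policy \<Rightarrow> bool" where
  "bang_bang p d \<longleftrightarrow> (\<forall>j \<in> {1..grp2 p}. d (grp1 p, j) = 0 \<or> d (grp1 p, j) = j)"

end

theory Submission
  imports Defs
begin

text \<open>
  Along the linear order of the states the chain is a birth-death chain, so its stationary vector
  is proportional to the weights \<open>\<lambda>^k * \<delta>\<^sub>k\<^sub>+\<^sub>1 * \<dots> * \<delta>\<^sub>N\<close>, where \<open>\<delta>\<^sub>i\<close> are the death rates. In this
  normalisation each weight is affine in every single death rate, and the average profit becomes, as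
  a function of one entry \<open>k = d (n, j) \<le> j\<close>, a quotient of two affine functions of \<open>k\<close> with
  positive denominator. If such a quotient attains its maximum at an interior point, then it is
  constant. Entries \<open>d (n, j) > j\<close> give the same chain as \<open>d (n, j) = j\<close> at a strictly larger power
  cost.
\<close>

text \<open>Left uncapped at \<open>last_index p\<close>, so that the map is injective on all of
  \<open>nat\<close> and turns \<open>next_state\<close> into \<open>Suc\<close> without side
  conditions.\<close>

definition nth_state :: "server_params \<Rightarrow> nat \<Rightarrow> state" where
  "nth_state p k = (if k \<le> grp1 p then (k, 0) else (grp1 p, k - grp1 p))"

abbreviation last_index :: "server_params \<Rightarrow> nat" where
  "last_index p \<equiv> grp1 p + grp2 p"

abbreviation nth_death :: "server_params \<Rightarrow> policy \<Rightarrow> nat \<Rightarrow> real" where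
  "nth_death p d k \<equiv> death_rate p d (nth_state p k)"

definition weight :: "server_params \<Rightarrow> policy \<Rightarrow> nat \<Rightarrow> real" where
  "weight p d k = lam p ^ k * (\<Prod>i\<in>{Suc k..last_index p}. nth_death p d i)"

definition total_weight :: "server_params \<Rightarrow> policy \<Rightarrow> real" where
  "total_weight p d = (\<Sum>k\<le>last_index p. weight p d k)"

definition weighted_reward :: "server_params \<Rightarrow> real \<Rightarrow> policy \<Rightarrow> real" where
  "weighted_reward p R d = (\<Sum>k\<le>last_index p. weight p d k * reward p R d (nth_state p k))"

subsection \<open>The stationary distribution\<close>

lemma inj_nth_state: "inj (nth_state p)"
  by (auto simp: inj_def nth_state_def split: if_splits)

lemma bij_betw_nth_state: "bij_betw (nth_state p) {..last_index p} (states p)"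
proof -
  have "s \<in> nth_state p ` {..last_index p}" if s: "s \<in> states p" for s
  proof -
    consider i where "i \<le> grp1 p" "s = (i, 0)"
      | j where "0 < j" "j \<le> grp2 p" "s = (grp1 p, j)"
      using s by (fastforce simp: states_def)
    then show ?thesis
    proof cases
      case 1
      then show ?thesis by (intro image_eqI[of _ _ i]) (auto simp: nth_state_def)
    next
      case 2
      then show ?thesis by (intro image_eqI[of _ _ "grp1 p + j"]) (auto simp: nth_state_def)
    qed
  qed
  moreover have "nth_state p k \<in> states p" if "k \<le> last_index p" for k
    using that by (auto simp: nth_state_def states_def)
  ultimately show ?thesis
    unfolding bij_betw_def by (auto intro: inj_on_subset[OF inj_nth_state])
qed

lemma finite_states: "finite (states p)"
  using bij_betw_finite[OF bij_betw_nth_state] by simp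

lemma sum_states: "(\<Sum>s\<in>states p. f s) = (\<Sum>k\<le>last_index p. f (nth_state p k))"
  by (rule sum.reindex_bij_betw[OF bij_betw_nth_state, symmetric])

lemma ball_states: "(\<forall>s\<in>states p. Q s) \<longleftrightarrow> (\<forall>k\<le>last_index p. Q (nth_state p k))"
  by (auto simp flip: bij_betw_imp_surj_on[OF bij_betw_nth_state])

lemma next_state_nth_state: "next_state p (nth_state p k) = nth_state p (Suc k)"
  by (auto simp: nth_state_def)

lemma trans_rate_nth_state:
  "trans_rate p d (nth_state p k) (nth_state p l) =
     (if k \<noteq> last_index p \<and> l = Suc k then lam p else if k = Suc l then nth_death p d k else 0)"
proof -
  have "(grp1 p, grp2 p) = nth_state p (last_index p)"
    by (auto simp: nth_state_def)
  then show ?thesis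
    using inj_nth_state[of p] unfolding trans_rate_def next_state_nth_state
    by (simp add: inj_eq)
qed

lemma exit_rate_nth_state:
  assumes "k \<le> last_index p"
  shows "(\<Sum>u\<in>states p - {nth_state p k}. trans_rate p d (nth_state p k) u) =
    (if k = last_index p then 0 else lam p) + (if k = 0 then 0 else nth_death p d k)"
proof -
  have "(\<Sum>u\<in>states p - {nth_state p k}. trans_rate p d (nth_state p k) u) =
     (\<Sum>u\<in>states p. trans_rate p d (nth_state p k) u)"
    by (rule sum.mono_neutral_left) (auto simp: finite_states trans_rate_nth_state)
  \<comment> \<open>One index test per summand lets each sum collapse. At \<open>k = 0\<close> the
    truncated \<open>k - 1\<close> is \<open>0\<close>, and the inner conditional supplies the value
    \<open>0\<close>.\<close>
  also have "\<dots> = (\<Sum>l\<le>last_index p.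
      (if l = Suc k then if k = last_index p then 0 else lam p else 0) +
      (if l = k - 1 then if k = 0 then 0 else nth_death p d k else 0))"
    unfolding sum_states by (rule sum.cong) (use assms in \<open>auto simp: trans_rate_nth_state\<close>)
  also have "\<dots> = (if k = last_index p then 0 else lam p) + (if k = 0 then 0 else nth_death p d k)"
    using assms by (auto simp: sum.distrib)
  finally show ?thesis .
qed

text \<open>Net probability flow across the cut between positions \<open>k\<close> and
  \<open>Suc k\<close>.\<close>

definition flux :: "server_params \<Rightarrow> policy \<Rightarrow> (state \<Rightarrow> real) \<Rightarrow> nat \<Rightarrow> real" where
  "flux p d \<pi> k = \<pi> (nth_state p k) * lam p - \<pi> (nth_state p (Suc k)) * nth_death p d (Suc k)"

text \<open>Only neighbours communicate, so the net inflow at a position enters across the cut on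
  its left and leaves across the cut on its right; each end of the line has just one cut.\<close>

lemma balance_eq_flux:
  assumes "l \<le> last_index p"
  shows "(\<Sum>s\<in>states p. \<pi> s * generator p d s (nth_state p l)) =
    (if l = 0 then 0 else flux p d \<pi> (l - 1)) - (if l = last_index p then 0 else flux p d \<pi> l)"
proof -
  let ?x = "\<lambda>k. \<pi> (nth_state p k)"
  let ?out = "(if l = last_index p then 0 else lam p) + (if l = 0 then 0 else nth_death p d l)"
  \<comment> \<open>Column \<open>l\<close> of the generator has at most three nonzero entries: the
    diagonal, the birth from \<open>l - 1\<close> and the death from \<open>Suc l\<close>.\<close>
  have "(\<Sum>s\<in>states p. \<pi> s * generator p d s (nth_state p l)) =
    (\<Sum>k\<le>last_index p. (if k = l then - ?x l * ?out else 0)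
      + (if k = l - 1 then if l = 0 then 0 else ?x (l - 1) * lam p else 0)
      + (if k = Suc l then ?x (Suc l) * nth_death p d (Suc l) else 0))"
    unfolding sum_states
  proof (rule sum.cong)
    fix k assume "k \<in> {..last_index p}"
    then have "k \<le> last_index p" by simp
    moreover have "nth_state p k = nth_state p l \<longleftrightarrow> k = l"
      using inj_nth_state by (simp add: inj_eq)
    ultimately show "?x k * generator p d (nth_state p k) (nth_state p l) =
      (if k = l then - ?x l * ?out else 0)
      + (if k = l - 1 then if l = 0 then 0 else ?x (l - 1) * lam p else 0)
      + (if k = Suc l then ?x (Suc l) * nth_death p d (Suc l) else 0)"
      using assms
      by (cases "k = l") (auto simp: generator_def exit_rate_nth_state trans_rate_nth_state algebra_simps)
  qed simp
  also have "\<dots> = - ?x l * ?out + (if l = 0 then 0 else ?x (l - 1) * lam p)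
      + (if l = last_index p then 0 else ?x (Suc l) * nth_death p d (Suc l))"
    using assms by (auto simp: sum.distrib)
  also have "\<dots> = (if l = 0 then 0 else flux p d \<pi> (l - 1)) -
      (if l = last_index p then 0 else flux p d \<pi> l)"
    by (cases l) (auto simp: flux_def algebra_simps)
  finally show ?thesis .
qed

text \<open>Global balance reduces to detailed balance: the equation at the left end kills the first
  flux, and each later equation carries the zero over to the next cut.\<close>

lemma balance_iff_flux_zero:
  "(\<forall>t\<in>states p. (\<Sum>s\<in>states p. \<pi> s * generator p d s t) = 0) \<longleftrightarrow>
   (\<forall>k<last_index p. flux p d \<pi> k = 0)"
proof
  assume bal: "\<forall>t\<in>states p. (\<Sum>s\<in>states p. \<pi> s * generator p d s t) = 0"
  have "flux p d \<pi> k = 0" if "k < last_index p" for k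
    using that
  proof (induction k)
    case 0
    then show ?case using bal balance_eq_flux[of 0 p \<pi> d] by (auto simp: ball_states split: if_splits)
  next
    case (Suc k)
    then show ?case using bal balance_eq_flux[of "Suc k" p \<pi> d] by (simp add: ball_states)
  qed
  then show "\<forall>k<last_index p. flux p d \<pi> k = 0" by blast
next
  assume "\<forall>k<last_index p. flux p d \<pi> k = 0"
  then show "\<forall>t\<in>states p. (\<Sum>s\<in>states p. \<pi> s * generator p d s t) = 0"
    by (auto simp: ball_states balance_eq_flux)
qed

section \<open>Product form and uniqueness of the stationary vector\<close>

locale positive_rates =
  fixes p :: server_params
  assumes grp1_pos: "grp1 p \<ge> 1"
    and lam_pos: "lam p > 0" and mu1_pos: "mu1 p > 0" and mu2_pos: "mu2 p > 0"
begin

text \<open>The group-1 term keeps the rate at \<open>(n, j)\<close> positive even when no group-2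
  server works there.\<close>

lemma nth_death_pos: "k \<ge> 1 \<Longrightarrow> nth_death p d k > 0"
  using grp1_pos mu1_pos mu2_pos by (auto simp: nth_state_def intro!: add_pos_nonneg)

lemma weight_pos: "weight p d k > 0"
  unfolding weight_def using lam_pos nth_death_pos by (intro mult_pos_pos prod_pos) auto

lemma total_weight_pos: "total_weight p d > 0"
  unfolding total_weight_def using weight_pos by (intro sum_pos) auto

lemma weight_Suc:
  assumes "k < last_index p"
  shows "weight p d k * lam p = weight p d (Suc k) * nth_death p d (Suc k)"
proof -
  have "{Suc k..last_index p} = insert (Suc k) {Suc (Suc k)..last_index p}"
    using assms by auto
  then show ?thesis by (simp add: weight_def)
qed

text \<open>Vanishing flux is a first-order recursion with nonzero coefficients, so its solutions
  form a line, and \<open>weight\<close> spans it.\<close>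

lemma flux_zero_iff_weight:
  "(\<forall>k<last_index p. flux p d \<pi> k = 0) \<longleftrightarrow>
   (\<exists>c. \<forall>k\<le>last_index p. \<pi> (nth_state p k) = c * weight p d k)"
proof
  assume flux: "\<forall>k<last_index p. flux p d \<pi> k = 0"
  define c where "c = \<pi> (nth_state p 0) / weight p d 0"
  have "\<pi> (nth_state p k) = c * weight p d k" if "k \<le> last_index p" for k
    using that
  proof (induction k)
    case 0
    then show ?case using weight_pos[of d 0] by (simp add: c_def)
  next
    case (Suc k)
    then have "flux p d \<pi> k = 0" and "\<pi> (nth_state p k) = c * weight p d k"
      using flux by auto
    then have "\<pi> (nth_state p (Suc k)) * nth_death p d (Suc k) = c * (weight p d k * lam p)"
      by (simp add: flux_def del: death_rate.simps)
    also have "\<dots> = c * weight p d (Suc k) * nth_death p d (Suc k)"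
      using Suc.prems by (simp add: weight_Suc)
    finally show ?case using nth_death_pos[of "Suc k" d] by simp
  qed
  then show "\<exists>c. \<forall>k\<le>last_index p. \<pi> (nth_state p k) = c * weight p d k" by blast
next
  assume "\<exists>c. \<forall>k\<le>last_index p. \<pi> (nth_state p k) = c * weight p d k"
  then show "\<forall>k<last_index p. flux p d \<pi> k = 0"
    by (auto simp: flux_def mult.assoc weight_Suc)
qed

lemma is_stationary_iff:
  "is_stationary p d \<pi> \<longleftrightarrow>
    (\<forall>s. s \<notin> states p \<longrightarrow> \<pi> s = 0) \<and>
    (\<forall>k\<le>last_index p. \<pi> (nth_state p k) = weight p d k / total_weight p d)"
proof
  assume st: "is_stationary p d \<pi>"
  then obtain c where c: "\<forall>k\<le>last_index p. \<pi> (nth_state p k) = c * weight p d k"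
    unfolding is_stationary_def balance_iff_flux_zero flux_zero_iff_weight by blast
  moreover have "c * total_weight p d = 1"
    using st c by (simp add: is_stationary_def sum_states total_weight_def sum_distrib_left)
  then have "c = 1 / total_weight p d"
    using total_weight_pos[of d] by (simp add: field_simps)
  ultimately show "(\<forall>s. s \<notin> states p \<longrightarrow> \<pi> s = 0) \<and>
    (\<forall>k\<le>last_index p. \<pi> (nth_state p k) = weight p d k / total_weight p d)"
    using st by (simp add: is_stationary_def)
next
  assume R: "(\<forall>s. s \<notin> states p \<longrightarrow> \<pi> s = 0) \<and>
    (\<forall>k\<le>last_index p. \<pi> (nth_state p k) = weight p d k / total_weight p d)"
  then have "\<exists>c. \<forall>k\<le>last_index p. \<pi> (nth_state p k) = c * weight p d k"
    by (intro exI[of _ "1 / total_weight p d"]) auto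
  moreover have "(\<Sum>s\<in>states p. \<pi> s) = 1"
    using R total_weight_pos[of d]
    by (simp add: sum_states flip: sum_divide_distrib total_weight_def)
  ultimately show "is_stationary p d \<pi>"
    using R less_imp_le[OF weight_pos] less_imp_le[OF total_weight_pos]
    unfolding is_stationary_def balance_iff_flux_zero flux_zero_iff_weight ball_states
    by simp
qed

lemma stationary_nth_state:
  assumes "k \<le> last_index p"
  shows "stationary p d (nth_state p k) = weight p d k / total_weight p d"
proof -
  have "\<exists>!\<pi>. is_stationary p d \<pi>"
  proof (rule ex_ex1I)
    \<comment> \<open>The value \<open>0\<close> outside \<open>states p\<close> is forced by
      \<open>is_stationary\<close>; it makes the vector unique as a total function.\<close>
    define \<pi> where "\<pi> s = (if s \<in> states p
      then weight p d (inv (nth_state p) s) / total_weight p d else 0)" for s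
    have "nth_state p k \<in> states p" if "k \<le> last_index p" for k
      using that ball_states[of p "\<lambda>s. s \<in> states p"] by blast
    then have "is_stationary p d \<pi>"
      by (simp add: is_stationary_iff \<pi>_def inj_nth_state)
    then show "\<exists>\<pi>. is_stationary p d \<pi>" by blast
  next
    fix \<pi> \<pi>' assume "is_stationary p d \<pi>" "is_stationary p d \<pi>'"
    then have "\<forall>s\<in>states p. \<pi> s = \<pi>' s" "\<forall>s. s \<notin> states p \<longrightarrow> \<pi> s = \<pi>' s"
      unfolding ball_states by (auto simp: is_stationary_iff)
    then show "\<pi> = \<pi>'" by blast
  qed
  then have "is_stationary p d (stationary p d)"
    unfolding stationary_def by (rule theI')
  then show ?thesis using assms by (simp add: is_stationary_iff)
qed

lemma avg_profit_eq: "avg_profit p R d = weighted_reward p R d / total_weight p d"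
  by (simp add: avg_profit_def weighted_reward_def sum_states stationary_nth_state sum_divide_distrib)

end

subsection \<open>Dependence on a single entry of the policy\<close>

text \<open>The range stops at \<open>j\<close> because rates and rewards contain
  \<open>min k j\<close>, which equals \<open>k\<close> only there.\<close>

definition affine_upto :: "nat \<Rightarrow> (nat \<Rightarrow> real) \<Rightarrow> bool" where
  "affine_upto j f \<longleftrightarrow> (\<exists>a b. \<forall>k\<le>j. f k = a + b * real k)"

lemma affine_upto_const: "affine_upto j (\<lambda>_. c)"
  unfolding affine_upto_def by (intro exI[of _ c] exI[of _ 0]) simp

lemma affine_upto_add:
  assumes "affine_upto j f" "affine_upto j g"
  shows "affine_upto j (\<lambda>k. f k + g k)"
proof -
  obtain a b a' b' where "\<forall>k\<le>j. f k = a + b * real k" "\<forall>k\<le>j. g k = a' + b' * real k"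
    using assms unfolding affine_upto_def by blast
  then show ?thesis
    unfolding affine_upto_def
    by (intro exI[of _ "a + a'"] exI[of _ "b + b'"]) (simp add: algebra_simps)
qed

lemma affine_upto_cmult:
  assumes "affine_upto j f"
  shows "affine_upto j (\<lambda>k. c * f k)"
proof -
  obtain a b where "\<forall>k\<le>j. f k = a + b * real k"
    using assms unfolding affine_upto_def by blast
  then show ?thesis
    unfolding affine_upto_def
    by (intro exI[of _ "c * a"] exI[of _ "c * b"]) (simp add: algebra_simps)
qed

lemma affine_upto_sum:
  assumes "\<And>i. i \<in> A \<Longrightarrow> affine_upto j (f i)"
  shows "affine_upto j (\<lambda>k. \<Sum>i\<in>A. f i k)"
  using assms
  by (induction A rule: infinite_finite_induct) (auto intro: affine_upto_const affine_upto_add)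

text \<open>With a zero at the interior point \<open>i\<close>, a positive slope would violate the
  bound at \<open>j\<close> and a negative slope the bound at \<open>0\<close>.\<close>

lemma affine_upto_interior_max:
  assumes "affine_upto j f" and nonpos: "\<And>k. k \<le> j \<Longrightarrow> f k \<le> 0"
    and "0 < i" "i < j" "f i = 0" "k \<le> j"
  shows "f k = 0"
proof -
  obtain a b where f: "\<And>k. k \<le> j \<Longrightarrow> f k = a + b * real k"
    using assms(1) unfolding affine_upto_def by blast
  have "a + b * real i = 0" using f[of i] assms by simp
  moreover have "a \<le> 0" using f[of 0] nonpos[of 0] by simp
  moreover have "a + b * real j \<le> 0" using f[of j] nonpos[of j] by simp
  ultimately have "b * real i \<ge> 0" "b * (real j - real i) \<le> 0"
    by (auto simp: algebra_simps)
  then have "b = 0"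
    using assms by (auto simp: zero_le_mult_iff mult_le_0_iff)
  then show ?thesis using f[of k] f[of i] assms by simp
qed

section \<open>Effect of one policy entry on rates, rewards and weights\<close>

lemma nth_state_eq_iff: "0 < j \<Longrightarrow> nth_state p k = (grp1 p, j) \<longleftrightarrow> k = grp1 p + j"
  by (auto simp: nth_state_def)

lemma nth_death_upd:
  assumes "0 < j"
  shows "nth_death p (d((grp1 p, j) := k)) i =
    (if i = grp1 p + j then real (grp1 p) * mu1 p + real (min k j) * mu2 p else nth_death p d i)"
  using assms by (auto simp: nth_state_def)

lemma reward_upd_other:
  assumes "0 < j" "i \<noteq> grp1 p + j"
  shows "reward p R (d((grp1 p, j) := k)) (nth_state p i) = reward p R d (nth_state p i)"
proof -
  have "nth_state p i \<noteq> (grp1 p, j)" using assms nth_state_eq_iff by blast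
  then show ?thesis by (cases "nth_state p i") auto
qed

lemma affine_upto_reward:
  "affine_upto j (\<lambda>k. reward p R (d((grp1 p, j) := k)) (grp1 p, j))"
  unfolding affine_upto_def
  \<comment> \<open>The slope is the net gain per additional working server: its service revenue
    minus the extra power cost over sleeping.\<close>
  by (intro exI[of _ "reward p R (d((grp1 p, j) := 0)) (grp1 p, j)"]
      exI[of _ "R * mu2 p - (P2W p - P2S p) * C1 p"])
    (auto simp: min_def algebra_simps)

text \<open>The modified death rate occurs at most once as a factor of the product.\<close>

lemma affine_upto_weight:
  assumes "0 < j"
  shows "affine_upto j (\<lambda>k. weight p (d((grp1 p, j) := k)) l)"
proof (cases "grp1 p + j \<in> {Suc l..last_index p}")
  case True
  let ?I = "{Suc l..last_index p} - {grp1 p + j}"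
  define c where "c = lam p ^ l * (\<Prod>i\<in>?I. nth_death p d i)"
  have "weight p (d((grp1 p, j) := k)) l =
      c * real (grp1 p) * mu1 p + c * mu2 p * real k" if "k \<le> j" for k
    using that assms
    by (simp add: weight_def prod.remove[OF _ True] nth_death_upd c_def algebra_simps)
  then show ?thesis unfolding affine_upto_def by blast
next
  case False
  then have "weight p (d((grp1 p, j) := k)) l = weight p d l" for k
    unfolding weight_def using assms
    by (intro arg_cong2[where f = "(*)"] prod.cong) (auto simp: nth_death_upd)
  then show ?thesis by (simp add: affine_upto_const)
qed

text \<open>The product defining a weight starts after its own index. This keeps a quadratic term
  out of the weighted reward.\<close>

lemma weight_upd_same:
  assumes "0 < j"
  shows "weight p (d((grp1 p, j) := k)) (grp1 p + j) = weight p d (grp1 p + j)"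
  unfolding weight_def using assms
  by (intro arg_cong2[where f = "(*)"] prod.cong) (auto simp: nth_death_upd)

lemma affine_upto_total_weight:
  "0 < j \<Longrightarrow> affine_upto j (\<lambda>k. total_weight p (d((grp1 p, j) := k)))"
  unfolding total_weight_def by (intro affine_upto_sum affine_upto_weight)

text \<open>In each summand at most one factor depends on \<open>k\<close>: the reward at position
  \<open>grp1 p + j\<close>, the weight at all others.\<close>

lemma affine_upto_weighted_reward:
  assumes "0 < j"
  shows "affine_upto j (\<lambda>k. weighted_reward p R (d((grp1 p, j) := k)))"
  unfolding weighted_reward_def
proof (rule affine_upto_sum)
  fix l
  show "affine_upto j (\<lambda>k. weight p (d((grp1 p, j) := k)) l *
      reward p R (d((grp1 p, j) := k)) (nth_state p l))"
  proof (cases "l = grp1 p + j")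
    case True
    then have "nth_state p l = (grp1 p, j)"
      using assms nth_state_eq_iff by blast
    then show ?thesis
      using affine_upto_cmult[OF affine_upto_reward] assms True by (simp only: weight_upd_same)
  next
    case False
    then show ?thesis
      using affine_upto_cmult[OF affine_upto_weight[OF assms], of "reward p R d (nth_state p l)"]
      by (simp only: reward_upd_other[OF assms] mult.commute not_False_eq_True)
  qed
qed

subsection \<open>Optimal policies\<close>

text \<open>Normalisation to \<open>0\<close> outside \<open>states p\<close> leaves only finitely
  many functions.\<close>

lemma finite_policies: "finite (policies p)"
proof (rule finite_subset)
  show "policies p \<subseteq> {d. \<forall>s. (s \<in> states p \<longrightarrow> d s \<in> {..grp2 p}) \<and> (s \<notin> states p \<longrightarrow> d s = 0)}"
    by (auto simp: policies_def)
  show "finite {d. \<forall>s. (s \<in> states p \<longrightarrow> d s \<in> {..grp2 p}) \<and> (s \<notin> states p \<longrightarrow> d s = 0)}"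
    using finite_states by (intro finite_set_of_finite_funs) auto
qed

lemma ex_optimal_policy: "\<exists>d. optimal_policy p R d"
proof -
  have "(\<lambda>_. 0) \<in> policies p" by (simp add: policies_def)
  then obtain d where "is_arg_min (\<lambda>d. - avg_profit p R d) (\<lambda>d. d \<in> policies p) d"
    using ex_is_arg_min_if_finite[OF finite_policies] by blast
  then have "optimal_policy p R d"
    by (simp add: optimal_policy_def is_arg_max_def is_arg_min_def)
  then show ?thesis by blast
qed

lemma optimal_policy_iff:
  "optimal_policy p R d \<longleftrightarrow>
    d \<in> policies p \<and> (\<forall>d'\<in>policies p. avg_profit p R d' \<le> avg_profit p R d)"
  by (auto simp: optimal_policy_def is_arg_max_def not_less)

lemma policies_upd:
  assumes "d \<in> policies p" "0 < j" "j \<le> grp2 p" "k \<le> grp2 p"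
  shows "d((grp1 p, j) := k) \<in> policies p"
  using assms by (auto simp: policies_def states_def)

section \<open>Changing one entry of an optimal policy\<close>

context positive_rates
begin

lemma optimal_policy_upd_interior:
  assumes opt: "optimal_policy p R d" and j: "j \<in> {1..grp2 p}"
    and interior: "0 < d (grp1 p, j)" "d (grp1 p, j) < j" and "k \<le> j"
  shows "optimal_policy p R (d((grp1 p, j) := k))"
proof -
  let ?d = "\<lambda>k. d((grp1 p, j) := k)"
  define \<eta> where "\<eta> = avg_profit p R d"
  \<comment> \<open>Clearing the denominator of the profit difference gives an affine function of
    \<open>k\<close> with the same sign, as \<open>total_weight\<close> is positive.\<close>
  define h where "h k = weighted_reward p R (?d k) + (- \<eta>) * total_weight p (?d k)" for k
  have h: "h k = (avg_profit p R (?d k) - \<eta>) * total_weight p (?d k)" for k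
    using total_weight_pos[of "?d k"] by (simp add: h_def avg_profit_eq field_simps)
  have pol: "?d k \<in> policies p" if "k \<le> j" for k
    using opt j that by (intro policies_upd) (auto simp: optimal_policy_iff)
  have "affine_upto j h"
    unfolding h_def using j
    by (intro affine_upto_add affine_upto_cmult affine_upto_weighted_reward
        affine_upto_total_weight) auto
  moreover have "h k \<le> 0" if "k \<le> j" for k
    using opt pol[OF that] less_imp_le[OF total_weight_pos]
    by (auto simp: h \<eta>_def optimal_policy_iff intro!: mult_nonpos_nonneg)
  \<comment> \<open>Updating the entry with its own value gives back \<open>d\<close>.\<close>
  moreover have "h (d (grp1 p, j)) = 0" by (simp add: h \<eta>_def)
  ultimately have "h k = 0"
    using affine_upto_interior_max[OF _ _ interior _ \<open>k \<le> j\<close>, of h] by blast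
  then have "avg_profit p R (?d k) = \<eta>"
    using total_weight_pos[of "?d k"] by (simp add: h)
  then show ?thesis
    using opt pol[OF \<open>k \<le> j\<close>] by (simp add: optimal_policy_iff \<eta>_def)
qed

lemma optimal_policy_le:
  assumes opt: "optimal_policy p R d" and j: "j \<in> {1..grp2 p}"
    and cost: "P2S p < P2W p" "0 < C1 p"
  shows "d (grp1 p, j) \<le> j"
proof (rule ccontr)
  assume "\<not> d (grp1 p, j) \<le> j"
  then have gt: "j < d (grp1 p, j)" by simp
  let ?d = "d((grp1 p, j) := j)"
  \<comment> \<open>Both policies have \<open>j\<close> as the minimum of their entry and
    \<open>j\<close>.\<close>
  have "nth_death p ?d i = nth_death p d i" for i
    using gt j by (simp add: nth_death_upd) (simp add: nth_state_def)
  then have w: "weight p ?d l = weight p d l" for l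
    by (simp add: weight_def)
  have st: "nth_state p (grp1 p + j) = (grp1 p, j)"
    using j by (simp add: nth_state_def)
  have "(P2W p - P2S p) * C1 p * (real (d (grp1 p, j)) - real j) > 0"
    using gt cost by simp
  then have less: "reward p R d (grp1 p, j) < reward p R ?d (grp1 p, j)"
    using gt by (simp add: algebra_simps)
  have "weighted_reward p R d < weighted_reward p R ?d"
    unfolding weighted_reward_def
  \<comment> \<open>Only the summand at \<open>grp1 p + j\<close> changes, and its weight is
    positive.\<close>
  proof (rule sum_strict_mono_ex1)
    show "\<forall>l\<in>{..last_index p}. weight p d l * reward p R d (nth_state p l)
        \<le> weight p ?d l * reward p R ?d (nth_state p l)"
    proof
      fix l
      show "weight p d l * reward p R d (nth_state p l)
        \<le> weight p ?d l * reward p R ?d (nth_state p l)"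
        using less st w j less_imp_le[OF weight_pos] reward_upd_other[of j l p R d j]
        by (cases "l = grp1 p + j") (auto intro!: mult_left_mono simp del: reward.simps)
    qed
    show "\<exists>l\<in>{..last_index p}. weight p d l * reward p R d (nth_state p l)
        < weight p ?d l * reward p R ?d (nth_state p l)"
      using less j weight_pos
      by (intro bexI[of _ "grp1 p + j"]) (auto simp: st w simp del: reward.simps)
  qed simp
  then have "avg_profit p R d < avg_profit p R ?d"
    using total_weight_pos[of d]
    by (simp add: avg_profit_eq total_weight_def w divide_strict_right_mono)
  moreover have "?d \<in> policies p"
    using opt j by (intro policies_upd) (auto simp: optimal_policy_iff)
  ultimately show False using opt by (force simp: optimal_policy_iff)
qed

text \<open>Among the optimal policies, one with the smallest sum of entries is bang-bang: resetting an
  interior entry to \<open>0\<close> would preserve optimality.\<close>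

lemma ex_optimal_bang_bang:
  assumes cost: "P2S p < P2W p" "0 < C1 p"
  shows "\<exists>d. optimal_policy p R d \<and> bang_bang p d"
proof -
  define size where "size d = (\<Sum>s\<in>states p. d s)" for d :: policy
  obtain d where opt: "optimal_policy p R d"
    and least: "\<And>d'. optimal_policy p R d' \<Longrightarrow> size d \<le> size d'"
    using ex_optimal_policy[of p R] ex_has_least_nat[of "optimal_policy p R" _ size] by metis
  have "d (grp1 p, j) = 0 \<or> d (grp1 p, j) = j" if j: "j \<in> {1..grp2 p}" for j
  proof (rule ccontr)
    assume "\<not> (d (grp1 p, j) = 0 \<or> d (grp1 p, j) = j)"
    then have interior: "0 < d (grp1 p, j)" "d (grp1 p, j) < j"
      using optimal_policy_le[OF opt j cost] by auto
    have "(grp1 p, j) \<in> states p" using j by (auto simp: states_def)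
    then have "size (d((grp1 p, j) := 0)) < size d"
      unfolding size_def using interior
      by (intro sum_strict_mono_ex1) (auto simp: finite_states intro!: bexI[of _ "(grp1 p, j)"])
    then show False
      using least[OF optimal_policy_upd_interior[OF opt j interior, of 0]] by simp
  qed
  then show ?thesis using opt unfolding bang_bang_def by blast
qed

end

theorem corollary1:
  fixes p :: server_params
  assumes "grp1 p \<ge> 1" and "grp2 p \<ge> 1"
    and "lam p > 0" and "mu1 p \<ge> mu2 p" and "mu2 p > 0"
    and "P1W p > 0" and "0 < P2S p" and "P2S p < P2W p"
    and "C1 p > 0" and "0 \<le> C2_1 p" and "C2_1 p \<le> C2_2 p"
    and "C3 p \<ge> 0" and "C4 p \<ge> 0"
  shows "\<forall>R \<ge> 0.
      (\<exists>d. optimal_policy p R d \<and> bang_bang p d) \<and>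
      (\<forall>d. optimal_policy p R d \<and> (\<forall>d'. optimal_policy p R d' \<longrightarrow> d' = d) \<longrightarrow> bang_bang p d) \<and>
      (\<forall>d. optimal_policy p R d \<longrightarrow>
        (\<forall>j \<in> {1..grp2 p}.
           d (grp1 p, j) = 0 \<or> d (grp1 p, j) = j \<or>
           (0 < d (grp1 p, j) \<and> d (grp1 p, j) < j \<and>
            (\<forall>k \<le> j. optimal_policy p R (d((grp1 p, j) := k))))))"
proof -
  interpret positive_rates p
    using assms by unfold_locales auto
  have ex: "\<exists>d. optimal_policy p R d \<and> bang_bang p d" for R
    using assms by (intro ex_optimal_bang_bang)
  have "d (grp1 p, j) = 0 \<or> d (grp1 p, j) = j \<or>
      (0 < d (grp1 p, j) \<and> d (grp1 p, j) < j \<and>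
        (\<forall>k\<le>j. optimal_policy p R (d((grp1 p, j) := k))))"
    if "optimal_policy p R d" "j \<in> {1..grp2 p}" for R d j
    using optimal_policy_le[OF that] optimal_policy_upd_interior[OF that] assms
    by (metis gr0I le_neq_implies_less)
  \<comment> \<open>If the optimum is unique, it coincides with the bang-bang optimum from
    \<open>ex\<close>.\<close>
  then show ?thesis using ex by metis
qed

end
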